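(* There exists a consistent meet APS $S=\langle L,\leq,\top,\bot,\Box,\boxtimes\rangle$ such that (i) for all $x,y,z\in L$, if $x\leq\Box y$ and $x\leq\boxtimes(y\land z)$, then $x\leq\boxtimes z$; (ii) for every $x\in L$, if $(\boxtimes x\land x)\leq\bot$, then $x\leq\bot$; and such that $\mathsf{E}_S(\triangle)$ fails for every one-variable APS term $\triangle v$ of odd degree.
   Context: An abstract provability structure (APS) is a tuple $S=\langle L,\leq,\top,\bot,\Box,\boxtimes\rangle$ where $L$ is a nonempty set, $\leq$ is a partial order on $L$, $\top,\bot\in L$, and $\Box,\boxtimes$ are unary operations on $L$ such that for all $x,y\in L$: (C1) if $x\leq y$ then $\Box x\leq\Box y$ and $\boxtimes y\leq\boxtimes x$; (C2) $\top\leq\boxtimes\bot$; (C3) if $x\leq\Box y$ and $x\leq\boxtimes y$ then $x\leq\boxtimes\top$; (C4) $\boxtimes x\leq\Box\boxtimes x$; (C5) $x\leq\top$. (It is not assumed that $\bot$ is the least element.) A meet APS is an APS for which $\langle L,\leq\rangle$ is a meet-semilattice; $x\land y$ denotes the meet. $S$ is consistent if $\top\not\leq\bot$. A one-variable APS term $\triangle v$ is generated from the variable $v$ by finitely many applications of $\Box$ and $\boxtimes$ (no $\land$); it induces a unary operation $x\mapsto\triangle x$ on $L$. The degree $d(\triangle)$ is the number of occurrences of $\boxtimes$ in $\triangle$. $\mathsf{E}_S(\triangle)$ means "$\triangle v$ has a fixed point in $S$", i.e. there is $p\in L$ with $\triangle p=p$. *)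

theory Defs
  imports Main "HOL-Algebra.Lattice"
begin

text \<open>The selectors \<open>verum\<close> and \<open>falsum\<close> are the distinguished elements top and bot of an abstract
  provability structure. They are independent record fields and not the library's \<open>top\<close> and
  \<open>bottom\<close>, since \<open>falsum\<close> need not be the least element. \<open>prov\<close> is the box operation,
  \<open>refut\<close> is the crossed box.\<close>

record 'a prov_struct = "'a gorder" +
  verum :: 'a
  falsum :: 'a
  prov :: "'a \<Rightarrow> 'a"
  refut :: "'a \<Rightarrow> 'a"

locale aps = partial_order S for S :: "('a, 'b) prov_struct_scheme" (structure) +
  assumes verum_closed: "verum S \<in> carrier S"
    and falsum_closed: "falsum S \<in> carrier S"
    and prov_closed: "x \<in> carrier S \<Longrightarrow> prov S x \<in> carrier S"
    and refut_closed: "x \<in> carrier S \<Longrightarrow> refut S x \<in> carrier S"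
    and prov_mono:
      "\<lbrakk>x \<in> carrier S; y \<in> carrier S; x \<sqsubseteq> y\<rbrakk> \<Longrightarrow> prov S x \<sqsubseteq> prov S y"
    and refut_antimono:
      "\<lbrakk>x \<in> carrier S; y \<in> carrier S; x \<sqsubseteq> y\<rbrakk> \<Longrightarrow> refut S y \<sqsubseteq> refut S x"
    and verum_le_refut_falsum: "verum S \<sqsubseteq> refut S (falsum S)"
    and le_refut_verum:
      "\<lbrakk>x \<in> carrier S; y \<in> carrier S; x \<sqsubseteq> prov S y; x \<sqsubseteq> refut S y\<rbrakk>
        \<Longrightarrow> x \<sqsubseteq> refut S (verum S)"
    and refut_le_prov_refut: "x \<in> carrier S \<Longrightarrow> refut S x \<sqsubseteq> prov S (refut S x)"
    and le_verum: "x \<in> carrier S \<Longrightarrow> x \<sqsubseteq> verum S"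

locale meet_aps = aps + lower_semilattice S

definition aps_consistent :: "('a, 'b) prov_struct_scheme \<Rightarrow> bool"
  where "aps_consistent S \<longleftrightarrow> \<not> verum S \<sqsubseteq>\<^bsub>S\<^esub> falsum S"

datatype aps_term = Var | Box aps_term | Refut aps_term

primrec eval_term :: "('a, 'b) prov_struct_scheme \<Rightarrow> aps_term \<Rightarrow> 'a \<Rightarrow> 'a" where
  "eval_term S Var x = x"
| "eval_term S (Box t) x = prov S (eval_term S t x)"
| "eval_term S (Refut t) x = refut S (eval_term S t x)"

primrec term_degree :: "aps_term \<Rightarrow> nat" where
  "term_degree Var = 0"
| "term_degree (Box t) = term_degree t"
| "term_degree (Refut t) = Suc (term_degree t)"

definition has_fixed_point :: "('a, 'b) prov_struct_scheme \<Rightarrow> aps_term \<Rightarrow> bool"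
  where "has_fixed_point S t \<longleftrightarrow> (\<exists>p \<in> carrier S. eval_term S t p = p)"

end

theory Submission
  imports Defs
begin

text \<open>A three-element chain suffices. Crossed box always takes its values in the two upper
  elements; there it is the transposition and box is the identity. A term of odd degree thus maps
  everything into the upper pair and acts on that pair as the transposition, so it fixes nothing.\<close>

definition chain_aps :: "nat prov_struct" where
  "chain_aps = \<lparr>carrier = {0, 1, 2}, eq = (=), le = (\<le>), verum = 2, falsum = 0,
    prov = max 1, refut = (\<lambda>x. if x = 2 then 1 else 2)\<rparr>"

lemma chain_aps_sel [simp]:
  "carrier chain_aps = {0, 1, 2}"
  "x .=\<^bsub>chain_aps\<^esub> y \<longleftrightarrow> x = y"
  "x \<sqsubseteq>\<^bsub>chain_aps\<^esub> y \<longleftrightarrow> x \<le> y"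
  "verum chain_aps = 2"
  "falsum chain_aps = 0"
  "prov chain_aps x = max 1 x"
  "refut chain_aps x = (if x = 2 then 1 else 2)"
  by (simp_all add: chain_aps_def)

lemma total_order_chain_aps: "total_order chain_aps"
  by unfold_locales (auto simp: fun_eq_iff)

lemma meet_aps_chain_aps: "meet_aps chain_aps"
proof -
  \<comment> \<open>Totality supplies the meets. Of the remaining axioms only
    \<open>le_refut_verum\<close> has content: \<open>prov\<close> reaches 2 only at 2, where
    \<open>refut\<close> drops to 1.\<close>
  interpret total_order chain_aps by (rule total_order_chain_aps)
  show ?thesis by unfold_locales auto
qed

text \<open>The library meet is given by a choice operator; \<open>min\<close> makes the finite case
  checks computable.\<close>

lemma meet_chain_aps:
  assumes "x \<in> carrier chain_aps" "y \<in> carrier chain_aps"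
  shows "x \<sqinter>\<^bsub>chain_aps\<^esub> y = min x y"
proof -
  interpret total_order chain_aps by (rule total_order_chain_aps)
  have "min x y \<in> carrier chain_aps"
    using assms by (simp add: min_def)
  then have "min x y \<le> x \<sqinter>\<^bsub>chain_aps\<^esub> y"
    using meet_le[OF _ _ assms, unfolded chain_aps_sel(3)] by simp
  moreover have "x \<sqinter>\<^bsub>chain_aps\<^esub> y \<le> min x y"
    using meet_left[OF assms] meet_right[OF assms] by simp
  ultimately show ?thesis by simp
qed

text \<open>On 1 and 2, \<open>3 - p\<close> is the transposition, so only the parity of the number
  of swaps matters.\<close>

lemma eval_term_upper:
  assumes "p \<in> {1, 2}"
  shows "eval_term chain_aps t p = (if even (term_degree t) then p else 3 - p)"
  using assms by (induction t) auto

text \<open>This also covers the start value 0: odd degree forces a \<open>Refut\<close>, which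
  lands in the pair from anywhere, and \<open>Box\<close> stays there.\<close>

lemma eval_term_odd_in_upper:
  assumes "odd (term_degree t)" "p \<in> carrier chain_aps"
  shows "eval_term chain_aps t p \<in> {1, 2}"
  using assms by (induction t) auto

lemma no_fixed_point_odd:
  assumes "odd (term_degree t)"
  shows "\<not> has_fixed_point chain_aps t"
proof
  assume "has_fixed_point chain_aps t"
  then obtain p where "p \<in> carrier chain_aps" and fp: "eval_term chain_aps t p = p"
    by (auto simp: has_fixed_point_def)
  then have "p \<in> {1, 2}"
    using eval_term_odd_in_upper[OF assms] by metis
  \<comment> \<open>\<open>3 - p = p\<close> would make 3 even.\<close>
  then show False
    using eval_term_upper[of p t] assms fp by auto
qed

theorem proposition7p17:
  shows "\<exists>S :: nat prov_struct.
    meet_aps S \<and> aps_consistent S \<and>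
    (\<forall>x \<in> carrier S. \<forall>y \<in> carrier S. \<forall>z \<in> carrier S.
       x \<sqsubseteq>\<^bsub>S\<^esub> prov S y \<and> x \<sqsubseteq>\<^bsub>S\<^esub> refut S (y \<sqinter>\<^bsub>S\<^esub> z) \<longrightarrow> x \<sqsubseteq>\<^bsub>S\<^esub> refut S z) \<and>
    (\<forall>x \<in> carrier S. refut S x \<sqinter>\<^bsub>S\<^esub> x \<sqsubseteq>\<^bsub>S\<^esub> falsum S \<longrightarrow> x \<sqsubseteq>\<^bsub>S\<^esub> falsum S) \<and>
    (\<forall>t. odd (term_degree t) \<longrightarrow> \<not> has_fixed_point S t)"
proof (intro exI[of _ chain_aps] conjI)
  \<comment> \<open>Only z = 2 can fail, since otherwise \<open>refut\<close> gives the top; then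
    the meet is y and the claim is \<open>le_refut_verum\<close>.\<close>
  show "\<forall>x \<in> carrier chain_aps. \<forall>y \<in> carrier chain_aps. \<forall>z \<in> carrier chain_aps.
      x \<sqsubseteq>\<^bsub>chain_aps\<^esub> prov chain_aps y \<and>
      x \<sqsubseteq>\<^bsub>chain_aps\<^esub> refut chain_aps (y \<sqinter>\<^bsub>chain_aps\<^esub> z) \<longrightarrow>
      x \<sqsubseteq>\<^bsub>chain_aps\<^esub> refut chain_aps z"
    by (simp add: meet_chain_aps)
  \<comment> \<open>\<open>refut\<close> is never 0, so on a chain the meet is 0 only if x
    is.\<close>
  show "\<forall>x \<in> carrier chain_aps.
      refut chain_aps x \<sqinter>\<^bsub>chain_aps\<^esub> x \<sqsubseteq>\<^bsub>chain_aps\<^esub> falsum chain_aps \<longrightarrow>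
      x \<sqsubseteq>\<^bsub>chain_aps\<^esub> falsum chain_aps"
    by (simp add: meet_chain_aps)
qed (simp_all add: meet_aps_chain_aps aps_consistent_def no_fixed_point_odd)

end
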